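(* There exist a query $\langle g(t),\mathcal{P}\rangle$, where $\mathcal{P}=(\mathcal{P}_R,\mathcal{P}_C)$ is a $\text{Datalog}^\vee$ program with constraints with $\mathcal{P}_C\neq\emptyset$, a database $D$, and a stable model $M\in\mathcal{SM}(Disj\_Magic(g(t),\mathcal{P})\cup D)$ such that $M[\mathcal{P}_D]$ is not a pre-model for $\mathcal{P}_D$.
   Context: **Syntax.** Fix alphabets of constants, variables and predicate symbols. A term is a constant or a variable; atoms are $p(t_1,\dots,t_k)$ with $t_i$ terms (no function symbols). Predicate symbols are either base (extensional) or derived (intensional). A database $D$ is a finite set of ground facts over base predicates. A $\text{Datalog}^\vee$ program with constraints is a pair $\mathcal{P}=(\mathcal{P}_R,\mathcal{P}_C)$ (identified with $\mathcal{P}_R\cup\mathcal{P}_C$), where $\mathcal{P}_R$ is a nonempty finite set of positive disjunctive rules $a_1\vee\cdots\vee a_m\leftarrow b_1,\dots,b_k$ ($m\ge1$, $k\ge 0$, $a_i$ derived atoms, $b_j$ base or derived atoms), and $\mathcal{P}_C$ is a finite set of constraints, i.e. rules with empty head $\leftarrow L_1,\dots,L_r$ whose $L_i$ are literals (atoms or negated atoms $\neg c$) with range restricted variables. Standing assumption: a predicate symbol does not appear both positively and negatively in two different constraints of $\mathcal{P}_C$. $\mathcal{P}_D$ denotes $\mathcal{P}\cup D$. A query is a pair $\langle g(t),\mathcal{P}\rangle$ where the goal $g(t)$ is an atom with $g$ a derived predicate of $\mathcal{P}$. **Semantics.** $ground(\mathcal{P})$ is the set of instances of rules of $\mathcal{P}$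 obtained by replacing variables with constants appearing in $\mathcal{P}$. An interpretation is a set of ground atoms over the predicates and constants of the program; it satisfies a ground rule if, whenever the body is true, some head atom is true (an empty head is false). A model satisfies all ground rules. $\mathcal{P}^I$ is obtained from $ground(\mathcal{P})$ by deleting all rules having a body literal $\neg a$ with $a\in I$ and deleting all negative literals from the remaining rules. $M$ is a stable model, $M\in\mathcal{SM}(\mathcal{P})$, iff $M$ is a $\subseteq$-minimal model of $\mathcal{P}^M$. For a set $I$ of ground atoms, $I[\mathcal{P}_D]$ is the set of atoms of $I$ whose predicate symbol appears in the head of some rule (or fact) of $\mathcal{P}_D$. An interpretation $M$ for $\mathcal{P}_D$ is a pre-model for $\mathcal{P}_D$ if there is $N\in\mathcal{SM}(\mathcal{P}_D)$ with $M\subseteq N$. **Rewriting $ESV$, $RV$.** $esv(\mathcal{P}_R)$: replace each rule $a_1\vee\cdots\vee a_m\leftarrow B$ of $\mathcal{P}_R$ by the rules $a_i\leftarrow B$ ($1\le i\le m$) and $a_i\leftarrow a_j,B$ ($i\ne j$). $esv(\mathcal{P}_C)$: replace each constraint $\leftarrow a_1,\dots,a_k,b_1,\dots,b_m,\neg c_1,\dots,\neg c_n$ ($a_i$ base atoms, $b_i$ derived atoms, $c_i$ base or derived) by the rules $b_i\leftarrow b_1,\dots,b_{i-1},b_{i+1},\dots,b_m,a_1,\dots,a_k,\neg c_1,\dots,\neg c_n$, $1\le i\le m$. $esv(\mathcal{P})=esv(\mathcal{P}_R)\cup esv(\mathcal{P}_C)$. $ESV(\mathcal{P})$ is obtained from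 $esv(\mathcal{P})$ by replacing every derived predicate symbol $p$ by a fresh, distinct predicate symbol $P$ of the same arity (these are the derived predicates of $ESV(\mathcal{P})$; base predicates are unchanged). For a derived atom $a=p(s)$ write $A=P(s)$. $RV(\mathcal{P}_R)=\{a_1\vee\cdots\vee a_m\leftarrow A_1,\dots,A_m,B : a_1\vee\cdots\vee a_m\leftarrow B\in\mathcal{P}_R\}$. **Magic-Set rewriting $Magic(G(t),\mathcal{S})$** of a program $\mathcal{S}$ with single-atom heads w.r.t. a goal $G(t)$. An adornment of a $k$-ary predicate is a string in $\{b,f\}^k$ (bound/free). (1) *Adornment.* The goal's adornment has $b$ at the constant arguments and $f$ at the variable arguments. Given a rule and an adornment $\alpha$ of its head, the distinctive arguments (terms) of the rule are the least set containing the head arguments bound in $\alpha$, all constants, and every argument of a positive base atom of the body that contains a distinctive argument. Each derived literal of the body gets the adornment with $b$ exactly at its distinctive arguments; the head predicate $q$ becomes $q^\alpha$. The adorned rules are generated for the goal's adorned predicate and then, repeatedly, for every new adorned predicate occurring in a generated body. (2) *Magic rules.* The fact $magic\_G^\alpha(t_b)$, where $t_b$ lists the bound arguments of the goal; and for each adorned rule with head $q^\alpha(s)$ and each derived literal with atom $p^\beta(u)$ in its body, the rule $magic\_p^\beta(u_b)\leftarrow magic\_q^\alpha(s_b),E$, where subscript $b$ keeps only arguments bound in the adornment and $E$ is the list of positive base atoms of the body (other derived literals are dropped). (3) *Modified rules.* Each adorned rule $q^\alpha(s)\leftarrow Body$ becomes $q^\alpha(s)\leftarrow magic\_q^\alpha(s_b),Body$.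 $Magic(G(t),\mathcal{S})$ is the set of all magic rules and modified rules. **Disjunctive Magic-Set.** $Coll(\mathcal{S},\mathcal{S}')$ is the set of rules $p(X_1,\dots,X_k)\leftarrow p^\alpha(X_1,\dots,X_k)$ for every predicate $p$ of $\mathcal{S}$ and every adorned version $p^\alpha$ of $p$ occurring in the adorned program $\mathcal{S}'$. With $G$ the symbol replacing $g$ in $ESV(\mathcal{P})$, $$Disj\_Magic(g(t),\mathcal{P})=RV(\mathcal{P}_R)\cup\mathcal{P}_C\cup Coll(ESV(\mathcal{P}),Magic(G(t),ESV(\mathcal{P})))\cup Magic(G(t),ESV(\mathcal{P})).$$ *)

theory Defs
  imports Main
begin

(* Variables are indexed by natural numbers; the alphabets of constants ('c) and of
   predicate names ('p) are arbitrary.  A predicate symbol of an input program is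
   Base n k or Derived n k, a name tagged with its kind and its arity k.  The remaining
   constructors provide the fresh symbols created by the rewritings: Upper p is the
   capital copy P of p, Adorned p \<alpha> is the adorned version of p and Magic p \<alpha> is the
   corresponding magic predicate. *)

datatype adn = Bnd | Fre

datatype 'p psym =
    Base 'p nat
  | Derived 'p nat
  | Upper "'p psym"
  | Adorned "'p psym" "adn list"
  | Magic "'p psym" "adn list"

fun is_base :: "'p psym \<Rightarrow> bool" where
  "is_base (Base n k) = True"
| "is_base _ = False"

fun is_derived :: "'p psym \<Rightarrow> bool" where
  "is_derived (Derived n k) = True"
| "is_derived _ = False"

fun arity :: "'p psym \<Rightarrow> nat" where
  "arity (Base n k) = k"
| "arity (Derived n k) = k"
| "arity (Upper p) = arity p"
| "arity (Adorned p \<alpha>) = arity p"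
| "arity (Magic p \<alpha>) = count_list \<alpha> Bnd"

datatype 'c trm = Const 'c | Var nat

datatype ('p, 'c) atm = Atom (pred: "'p psym") (args: "'c trm list")

(* Rule hs ps ns is the rule with head the disjunction of hs and body the atoms ps
   together with the negated atoms ns; a constraint has hs = []. *)
datatype ('p, 'c) rule =
  Rule (heads: "('p, 'c) atm list") (pbody: "('p, 'c) atm list") (nbody: "('p, 'c) atm list")

definition atoms :: "('p, 'c) rule \<Rightarrow> ('p, 'c) atm set" where
  "atoms r = set (heads r) \<union> set (pbody r) \<union> set (nbody r)"

definition atm_vars :: "('p, 'c) atm \<Rightarrow> nat set" where
  "atm_vars a = {x. Var x \<in> set (args a)}"

definition atm_consts :: "('p, 'c) atm \<Rightarrow> 'c set" where
  "atm_consts a = {c. Const c \<in> set (args a)}"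

definition vars :: "('p, 'c) rule \<Rightarrow> nat set" where
  "vars r = (\<Union>a\<in>atoms r. atm_vars a)"

definition consts_of :: "('p, 'c) rule set \<Rightarrow> 'c set" where
  "consts_of P = (\<Union>r\<in>P. \<Union>a\<in>atoms r. atm_consts a)"

definition preds :: "('p, 'c) rule set \<Rightarrow> 'p psym set" where
  "preds P = (\<Union>r\<in>P. pred ` atoms r)"

definition head_preds :: "('p, 'c) rule set \<Rightarrow> 'p psym set" where
  "head_preds P = (\<Union>r\<in>P. pred ` set (heads r))"

definition wf_atm :: "('p, 'c) atm \<Rightarrow> bool" where
  "wf_atm a \<longleftrightarrow> (is_base (pred a) \<or> is_derived (pred a)) \<and> length (args a) = arity (pred a)"

definition disjunctive_rule :: "('p, 'c) rule \<Rightarrow> bool" where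
  "disjunctive_rule r \<longleftrightarrow>
     heads r \<noteq> [] \<and> nbody r = [] \<and> (\<forall>a\<in>atoms r. wf_atm a) \<and>
     (\<forall>a\<in>set (heads r). is_derived (pred a))"

(* The last conjunct is range restriction: every variable occurs in a positive literal. *)
definition constraint :: "('p, 'c) rule \<Rightarrow> bool" where
  "constraint r \<longleftrightarrow>
     heads r = [] \<and> (pbody r \<noteq> [] \<or> nbody r \<noteq> []) \<and> (\<forall>a\<in>atoms r. wf_atm a) \<and>
     vars r \<subseteq> (\<Union>a\<in>set (pbody r). atm_vars a)"

definition datalog_program :: "('p, 'c) rule set \<Rightarrow> ('p, 'c) rule set \<Rightarrow> bool" where
  "datalog_program PR PC \<longleftrightarrow>
     finite PR \<and> PR \<noteq> {} \<and> (\<forall>r\<in>PR. disjunctive_rule r) \<and>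
     finite PC \<and> (\<forall>r\<in>PC. constraint r) \<and>
     (\<forall>r\<in>PC. \<forall>r'\<in>PC. r \<noteq> r' \<longrightarrow> pred ` set (pbody r) \<inter> pred ` set (nbody r') = {})"

definition database :: "('p, 'c) atm set \<Rightarrow> bool" where
  "database D \<longleftrightarrow>
     finite D \<and> (\<forall>a\<in>D. wf_atm a \<and> is_base (pred a) \<and> atm_vars a = {})"

definition facts :: "('p, 'c) atm set \<Rightarrow> ('p, 'c) rule set" where
  "facts D = {Rule [a] [] [] | a. a \<in> D}"

definition query :: "('p, 'c) atm \<Rightarrow> ('p, 'c) rule set \<Rightarrow> ('p, 'c) rule set \<Rightarrow> bool" where
  "query g PR PC \<longleftrightarrow>
     datalog_program PR PC \<and> wf_atm g \<and> is_derived (pred g) \<and> pred g \<in> preds (PR \<union> PC)"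


fun inst_trm :: "(nat \<Rightarrow> 'c) \<Rightarrow> 'c trm \<Rightarrow> 'c trm" where
  "inst_trm \<sigma> (Const c) = Const c"
| "inst_trm \<sigma> (Var x) = Const (\<sigma> x)"

definition inst_atm :: "(nat \<Rightarrow> 'c) \<Rightarrow> ('p, 'c) atm \<Rightarrow> ('p, 'c) atm" where
  "inst_atm \<sigma> a = Atom (pred a) (map (inst_trm \<sigma>) (args a))"

definition inst_rule :: "(nat \<Rightarrow> 'c) \<Rightarrow> ('p, 'c) rule \<Rightarrow> ('p, 'c) rule" where
  "inst_rule \<sigma> r =
     Rule (map (inst_atm \<sigma>) (heads r)) (map (inst_atm \<sigma>) (pbody r)) (map (inst_atm \<sigma>) (nbody r))"

(* Only the variables of r are restricted to the constants of P, so that a variable-free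
   rule is its own instance even if P contains no constant. *)
definition ground :: "('p, 'c) rule set \<Rightarrow> ('p, 'c) rule set" where
  "ground P = {inst_rule \<sigma> r | \<sigma> r. r \<in> P \<and> (\<forall>x\<in>vars r. \<sigma> x \<in> consts_of P)}"

definition interpretation_of :: "('p, 'c) rule set \<Rightarrow> ('p, 'c) atm set \<Rightarrow> bool" where
  "interpretation_of P I \<longleftrightarrow>
     I \<subseteq> {Atom p (map Const cs) | p cs.
            p \<in> preds P \<and> length cs = arity p \<and> set cs \<subseteq> consts_of P}"

definition satisfies :: "('p, 'c) atm set \<Rightarrow> ('p, 'c) rule \<Rightarrow> bool" where
  "satisfies I r \<longleftrightarrow>
     (\<forall>b\<in>set (pbody r). b \<in> I) \<and> (\<forall>c\<in>set (nbody r). c \<notin> I) \<longrightarrow> (\<exists>a\<in>set (heads r). a \<in> I)"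

definition model :: "('p, 'c) rule set \<Rightarrow> ('p, 'c) atm set \<Rightarrow> bool" where
  "model P I \<longleftrightarrow> (\<forall>r\<in>ground P. satisfies I r)"

definition reduct :: "('p, 'c) rule set \<Rightarrow> ('p, 'c) atm set \<Rightarrow> ('p, 'c) rule set" where
  "reduct P I =
     {Rule (heads r) (pbody r) [] | r. r \<in> ground P \<and> (\<forall>c\<in>set (nbody r). c \<notin> I)}"

definition SM :: "('p, 'c) rule set \<Rightarrow> ('p, 'c) atm set set" where
  "SM P = {M. interpretation_of P M \<and> model (reduct P M) M \<and>
              (\<forall>N. N \<subset> M \<longrightarrow> \<not> model (reduct P M) N)}"

definition restrict_to :: "('p, 'c) atm set \<Rightarrow> ('p, 'c) rule set \<Rightarrow> ('p, 'c) atm set" where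
  "restrict_to I P = {a \<in> I. pred a \<in> head_preds P}"

definition pre_model :: "('p, 'c) rule set \<Rightarrow> ('p, 'c) atm set \<Rightarrow> bool" where
  "pre_model P M \<longleftrightarrow> interpretation_of P M \<and> (\<exists>N\<in>SM P. M \<subseteq> N)"


definition esv_rules :: "('p, 'c) rule set \<Rightarrow> ('p, 'c) rule set" where
  "esv_rules PR =
     {Rule [heads r ! i] (pbody r) (nbody r) | r i. r \<in> PR \<and> i < length (heads r)} \<union>
     {Rule [heads r ! i] ((heads r ! j) # pbody r) (nbody r) | r i j.
        r \<in> PR \<and> i < length (heads r) \<and> j < length (heads r) \<and> i \<noteq> j}"

definition base_atms :: "('p, 'c) atm list \<Rightarrow> ('p, 'c) atm list" where
  "base_atms as = filter (\<lambda>a. is_base (pred a)) as"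

definition nonbase_atms :: "('p, 'c) atm list \<Rightarrow> ('p, 'c) atm list" where
  "nonbase_atms as = filter (\<lambda>a. \<not> is_base (pred a)) as"

definition esv_constraints :: "('p, 'c) rule set \<Rightarrow> ('p, 'c) rule set" where
  "esv_constraints PC =
     {Rule [bs ! i] (take i bs @ drop (Suc i) bs @ base_atms (pbody r)) (nbody r) | r bs i.
        r \<in> PC \<and> bs = nonbase_atms (pbody r) \<and> i < length bs}"

definition upper_atm :: "('p, 'c) atm \<Rightarrow> ('p, 'c) atm" where
  "upper_atm a = (if is_base (pred a) then a else Atom (Upper (pred a)) (args a))"

definition upper_rule :: "('p, 'c) rule \<Rightarrow> ('p, 'c) rule" where
  "upper_rule r =
     Rule (map upper_atm (heads r)) (map upper_atm (pbody r)) (map upper_atm (nbody r))"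

definition ESV :: "('p, 'c) rule set \<Rightarrow> ('p, 'c) rule set \<Rightarrow> ('p, 'c) rule set" where
  "ESV PR PC = upper_rule ` (esv_rules PR \<union> esv_constraints PC)"

definition RV :: "('p, 'c) rule set \<Rightarrow> ('p, 'c) rule set" where
  "RV PR = {Rule (heads r) (map upper_atm (heads r) @ pbody r) (nbody r) | r. r \<in> PR}"


(* In the magic-set rewriting of a program S the derived predicates of S are its
   non-base ones. *)

definition goal_adornment :: "('p, 'c) atm \<Rightarrow> adn list" where
  "goal_adornment g = map (\<lambda>t. case t of Const c \<Rightarrow> Bnd | Var x \<Rightarrow> Fre) (args g)"

definition bound_args :: "adn list \<Rightarrow> 'c trm list \<Rightarrow> 'c trm list" where
  "bound_args \<alpha> ts = map fst (filter (\<lambda>(t, b). b = Bnd) (zip ts \<alpha>))"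

(* Distinctive terms of a rule with head atom h, positive body ps and head adornment \<alpha>. *)
inductive_set distinctive :: "('p, 'c) atm \<Rightarrow> ('p, 'c) atm list \<Rightarrow> adn list \<Rightarrow> 'c trm set"
  for h :: "('p, 'c) atm" and ps :: "('p, 'c) atm list" and \<alpha> :: "adn list"
where
  bound_head: "t \<in> set (bound_args \<alpha> (args h)) \<Longrightarrow> t \<in> distinctive h ps \<alpha>"
| const_arg: "Const c \<in> distinctive h ps \<alpha>"
| base_atom: "\<lbrakk>a \<in> set ps; is_base (pred a); s \<in> set (args a); s \<in> distinctive h ps \<alpha>;
    t \<in> set (args a)\<rbrakk> \<Longrightarrow> t \<in> distinctive h ps \<alpha>"

definition adorn_atm :: "'c trm set \<Rightarrow> ('p, 'c) atm \<Rightarrow> ('p, 'c) atm" where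
  "adorn_atm T a =
     (if is_base (pred a) then a
      else Atom (Adorned (pred a) (map (\<lambda>t. if t \<in> T then Bnd else Fre) (args a))) (args a))"

definition adorn_rule :: "('p, 'c) atm \<Rightarrow> ('p, 'c) atm list \<Rightarrow> ('p, 'c) atm list \<Rightarrow> adn list \<Rightarrow>
    ('p, 'c) rule" where
  "adorn_rule h ps ns \<alpha> =
     Rule [Atom (Adorned (pred h) \<alpha>) (args h)]
       (map (adorn_atm (distinctive h ps \<alpha>)) ps) (map (adorn_atm (distinctive h ps \<alpha>)) ns)"

inductive_set adorned :: "('p, 'c) atm \<Rightarrow> ('p, 'c) rule set \<Rightarrow> ('p, 'c) rule set"
  for g :: "('p, 'c) atm" and S :: "('p, 'c) rule set"
where
  goal: "\<lbrakk>Rule [h] ps ns \<in> S; pred h = pred g\<rbrakk> \<Longrightarrow>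
    adorn_rule h ps ns (goal_adornment g) \<in> adorned g S"
| step: "\<lbrakk>r \<in> adorned g S; Atom (Adorned p \<beta>) u \<in> set (pbody r) \<union> set (nbody r);
    Rule [h] ps ns \<in> S; pred h = p\<rbrakk> \<Longrightarrow> adorn_rule h ps ns \<beta> \<in> adorned g S"

definition magic_rules :: "('p, 'c) atm \<Rightarrow> ('p, 'c) rule set \<Rightarrow> ('p, 'c) rule set" where
  "magic_rules g S =
     {Rule [Atom (Magic (pred g) (goal_adornment g)) (bound_args (goal_adornment g) (args g))] [] []}
     \<union> {Rule [Atom (Magic p \<beta>) (bound_args \<beta> u)]
             (Atom (Magic q \<alpha>) (bound_args \<alpha> s) # base_atms ps) [] | p \<beta> u q \<alpha> s ps ns.
          Rule [Atom (Adorned q \<alpha>) s] ps ns \<in> adorned g S \<and>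
          Atom (Adorned p \<beta>) u \<in> set ps \<union> set ns}"

definition modified_rules :: "('p, 'c) atm \<Rightarrow> ('p, 'c) rule set \<Rightarrow> ('p, 'c) rule set" where
  "modified_rules g S =
     {Rule [Atom (Adorned q \<alpha>) s] (Atom (Magic q \<alpha>) (bound_args \<alpha> s) # ps) ns | q \<alpha> s ps ns.
        Rule [Atom (Adorned q \<alpha>) s] ps ns \<in> adorned g S}"

definition magic :: "('p, 'c) atm \<Rightarrow> ('p, 'c) rule set \<Rightarrow> ('p, 'c) rule set" where
  "magic g S = magic_rules g S \<union> modified_rules g S"

definition Coll :: "('p, 'c) rule set \<Rightarrow> ('p, 'c) rule set \<Rightarrow> ('p, 'c) rule set" where
  "Coll S S' =
     {Rule [Atom p (map Var [0..<arity p])] [Atom (Adorned p \<alpha>) (map Var [0..<arity p])] [] | p \<alpha>.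
        p \<in> preds S \<and> Adorned p \<alpha> \<in> preds S'}"

definition disj_magic :: "('p, 'c) atm \<Rightarrow> ('p, 'c) rule set \<Rightarrow> ('p, 'c) rule set \<Rightarrow>
    ('p, 'c) rule set" where
  "disj_magic g PR PC =
     (let S = ESV PR PC; S' = magic (upper_atm g) S in RV PR \<union> PC \<union> Coll S S' \<union> S')"

end

theory Submission
  imports Defs
begin

text \<open>
  Let the rules be the facts \<open>g\<close> and \<open>q(c)\<close>, with the constraint \<open>\<leftarrow> q(c)\<close> and the
  goal \<open>g\<close>. The program is inconsistent, so it has no pre-model at all. Since \<open>q\<close> is irrelevant
  to the goal, the magic-set rewriting produces no rule for its adorned versions: in the rewritten
  program \<open>q(c)\<close> depends on an atom that is never derived, the constraint holds vacuously, and a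
  stable model exists.
\<close>

text \<open>The types of names and constants are arbitrary and may have a single element, so
  \<open>undefined\<close> serves as every name and constant. The arities 0 and 1 keep the
  predicates of \<open>goal_atm\<close> and \<open>bad_atm\<close> apart.\<close>

definition goal_atm :: "('p, 'c) atm" where
  "goal_atm = Atom (Derived undefined 0) []"

definition bad_atm :: "('p, 'c) atm" where
  "bad_atm = Atom (Derived undefined 1) [Const undefined]"

definition prog :: "('p, 'c) rule set" where
  "prog = {Rule [goal_atm] [] [], Rule [bad_atm] [] []}"

definition constrs :: "('p, 'c) rule set" where
  "constrs = {Rule [] [bad_atm] []}"

definition adorned_goal :: "('p, 'c) atm" where
  "adorned_goal = Atom (Adorned (Upper (Derived undefined 0)) []) []"

definition magic_goal :: "('p, 'c) atm" where
  "magic_goal = Atom (Magic (Upper (Derived undefined 0)) []) []"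

lemmas atm_defs = goal_atm_def bad_atm_def adorned_goal_def magic_goal_def

lemma facts_empty [simp]: "facts {} = {}"
  by (simp add: facts_def)

lemma inst_trm_ground: "(\<And>x. t \<noteq> Var x) \<Longrightarrow> inst_trm \<sigma> t = t"
  by (cases t) auto

lemma inst_atm_ground: "atm_vars a = {} \<Longrightarrow> inst_atm \<sigma> a = a"
  unfolding inst_atm_def atm_vars_def
  by (cases a) (auto intro!: map_idI inst_trm_ground)

lemma inst_rule_ground: "vars r = {} \<Longrightarrow> inst_rule \<sigma> r = r"
  by (cases r) (auto simp: inst_rule_def vars_def atoms_def inst_atm_ground intro!: map_idI)

lemma ground_variable_free:
  assumes "\<forall>r\<in>P. vars r = {}"
  shows "ground P = P"
proof -
  have "r \<in> ground P" if "r \<in> P" for r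
    using that assms inst_rule_ground[of r] unfolding ground_def
    \<comment> \<open>Any substitution will do: without variables the restriction to program
      constants is vacuous.\<close>
    by (intro CollectI exI[of _ "\<lambda>_. undefined"] exI[of _ r]) auto
  moreover have "r \<in> P" if "r \<in> ground P" for r
    using that assms inst_rule_ground unfolding ground_def by fastforce
  ultimately show ?thesis by blast
qed

lemma reduct_variable_free_positive:
  assumes "\<forall>r\<in>P. vars r = {}" "\<forall>r\<in>P. nbody r = []"
  shows "reduct P I = P"
proof -
  have *: "Rule (heads r) (pbody r) [] = r" if "r \<in> P" for r
    using assms(2) that by (cases r) auto
  have "reduct P I = {Rule (heads r) (pbody r) [] | r. r \<in> P}"
    using assms(2) unfolding reduct_def ground_variable_free[OF assms(1)]
    by (intro Collect_cong) (metis empty_iff empty_set)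
  also have "\<dots> = (\<lambda>r. Rule (heads r) (pbody r) []) ` P" by blast
  also have "\<dots> = P"
    using * by simp
  finally show ?thesis .
qed

text \<open>Grounding and the reduct both leave such a program unchanged, so stable models are just
  its minimal models.\<close>

lemma SM_variable_free_positive:
  assumes "\<forall>r\<in>P. vars r = {}" "\<forall>r\<in>P. nbody r = []"
  shows "M \<in> SM P \<longleftrightarrow> interpretation_of P M \<and> (\<forall>r\<in>P. satisfies M r) \<and>
    (\<forall>N. N \<subset> M \<longrightarrow> \<not> (\<forall>r\<in>P. satisfies N r))"
  by (simp add: SM_def model_def reduct_variable_free_positive[OF assms]
      ground_variable_free[OF assms(1)])

text \<open>With single-atom heads there is nothing to shift, and the constraint turns into a
  bodiless rule for \<open>bad_atm\<close>, which coincides with the fact already present.\<close>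

lemma ESV_eq:
  "ESV prog constrs =
    ({Rule [upper_atm goal_atm] [] [], Rule [upper_atm bad_atm] [] []} :: ('p, 'c) rule set)"
proof -
  have "r \<in> esv_rules prog" if "r \<in> prog" for r :: "('p, 'c) rule"
  proof -
    have "r = Rule [heads r ! 0] (pbody r) (nbody r) \<and> r \<in> prog \<and> 0 < length (heads r)"
      using that by (auto simp: prog_def)
    then show ?thesis unfolding esv_rules_def by blast
  qed
  moreover have "esv_rules prog \<subseteq> prog"
    by (auto simp: esv_rules_def prog_def)
  ultimately have "esv_rules (prog :: ('p, 'c) rule set) = prog" by blast
  moreover have "esv_constraints constrs = {Rule [bad_atm] [] [] :: ('p, 'c) rule}"
    by (auto simp: esv_constraints_def constrs_def base_atms_def nonbase_atms_def bad_atm_def)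
  ultimately show ?thesis
    by (auto simp: ESV_def prog_def upper_rule_def)
qed

text \<open>The rule for the goal has an empty body, so no further predicate is ever reached and the
  rule for \<open>bad_atm\<close> is never adorned.\<close>

lemma adorned_eq:
  "adorned (upper_atm goal_atm) (ESV prog constrs) = {Rule [adorned_goal] [] [] :: ('p, 'c) rule}"
proof -
  have "r = Rule [adorned_goal] [] []"
    if "r \<in> adorned (upper_atm goal_atm) (ESV prog constrs)" for r :: "('p, 'c) rule"
    using that
    by induction (auto simp: ESV_eq adorn_rule_def upper_atm_def atm_defs goal_adornment_def)
  moreover have "(Rule [adorned_goal] [] [] :: ('p, 'c) rule)
      \<in> adorned (upper_atm goal_atm) (ESV prog constrs)"
    using adorned.goal[of "upper_atm goal_atm" "[]" "[]" "ESV prog constrs" "upper_atm goal_atm"]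
    by (simp add: ESV_eq adorn_rule_def upper_atm_def atm_defs goal_adornment_def)
  ultimately show ?thesis by blast
qed

lemma magic_eq:
  "magic (upper_atm goal_atm) (ESV prog constrs) =
    {Rule [magic_goal] [] [], Rule [adorned_goal] [magic_goal] []}"
  by (auto simp: magic_def magic_rules_def modified_rules_def adorned_eq)
    (auto simp: atm_defs upper_atm_def goal_adornment_def bound_args_def)

text \<open>What matters is that no rule has head \<open>upper_atm bad_atm\<close>: collecting rules
  exist only for predicates with an adorned version.\<close>

lemma disj_magic_eq:
  "disj_magic goal_atm prog constrs =
    {Rule [goal_atm] [upper_atm goal_atm] [] :: ('p, 'c) rule, Rule [bad_atm] [upper_atm bad_atm] [],
     Rule [] [bad_atm] [], Rule [upper_atm goal_atm] [adorned_goal] [],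
     Rule [magic_goal] [] [], Rule [adorned_goal] [magic_goal] []}"
proof -
  have "Coll (ESV prog constrs) (magic (upper_atm goal_atm) (ESV prog constrs)) =
      {Rule [upper_atm goal_atm] [adorned_goal] [] :: ('p, 'c) rule}"
    unfolding Coll_def magic_eq unfolding ESV_eq
    by (auto simp: preds_def atoms_def atm_defs upper_atm_def)
  moreover have "RV prog =
      {Rule [goal_atm] [upper_atm goal_atm] [] :: ('p, 'c) rule, Rule [bad_atm] [upper_atm bad_atm] []}"
    unfolding RV_def prog_def
    by (simp add: conj_disj_distribL conj_disj_distribR ex_disj_distrib Collect_disj_eq) blast
  ultimately show ?thesis
    unfolding disj_magic_def Let_def magic_eq by (auto simp: constrs_def)
qed

lemma stable_disj_magic:
  "{magic_goal, adorned_goal, upper_atm goal_atm, goal_atm} \<in> SM (disj_magic goal_atm prog constrs)"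
    (is "?M \<in> SM ?P")
proof -
  have "interpretation_of ?P ?M"
    unfolding interpretation_of_def disj_magic_eq
    by (auto simp: preds_def atoms_def atm_defs upper_atm_def)
  moreover have "\<forall>r\<in>?P. satisfies ?M r"
    unfolding disj_magic_eq by (auto simp: satisfies_def atm_defs upper_atm_def)
  \<comment> \<open>From the fact \<open>magic_goal\<close> the rules derive
    \<open>adorned_goal\<close>, \<open>upper_atm goal_atm\<close> and \<open>goal_atm\<close> in
    turn, so every model contains all four, which gives minimality.\<close>
  moreover have "?M \<subseteq> N" if "\<forall>r\<in>?P. satisfies N r" for N
    using that unfolding disj_magic_eq by (simp add: satisfies_def)
  then have "\<not> (\<forall>r\<in>?P. satisfies N r)" if "N \<subset> ?M" for N
    using that by (meson leD)
  moreover have "\<forall>r\<in>?P. vars r = {}" "\<forall>r\<in>?P. nbody r = []"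
    unfolding disj_magic_eq
    by (auto simp: vars_def atoms_def atm_vars_def atm_defs upper_atm_def)
  ultimately show ?thesis
    by (simp add: SM_variable_free_positive)
qed

text \<open>The fact \<open>bad_atm\<close> contradicts the constraint, so there is not even a
  model.\<close>

lemma SM_empty: "SM (prog \<union> constrs) = {}"
proof -
  have "\<forall>r\<in>(prog \<union> constrs) :: ('p, 'c) rule set. vars r = {}"
    "\<forall>r\<in>(prog \<union> constrs) :: ('p, 'c) rule set. nbody r = []"
    by (auto simp: prog_def constrs_def vars_def atoms_def atm_vars_def atm_defs)
  note SM_iff = SM_variable_free_positive[OF this]
  have "M \<notin> SM (prog \<union> constrs)" for M :: "('p, 'c) atm set"
    unfolding SM_iff by (simp add: prog_def constrs_def satisfies_def)
  then show ?thesis by blast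
qed

lemma query_goal: "query goal_atm prog constrs"
  by (auto simp: query_def datalog_program_def prog_def constrs_def disjunctive_rule_def
      constraint_def wf_atm_def atoms_def vars_def atm_vars_def preds_def atm_defs)

theorem lemma3:
  shows "\<exists>(PR :: ('p, 'c) rule set) PC g D M.
    query g PR PC \<and> PC \<noteq> {} \<and> database D \<and>
    M \<in> SM (disj_magic g PR PC \<union> facts D) \<and>
    \<not> pre_model (PR \<union> PC \<union> facts D) (restrict_to M (PR \<union> PC \<union> facts D))"
proof (intro exI conjI)
  show "query goal_atm prog constrs" by (rule query_goal)
  show "constrs \<noteq> {}" by (simp add: constrs_def)
  show "database {}" by (simp add: database_def)
  show "{magic_goal, adorned_goal, upper_atm goal_atm, goal_atm}
      \<in> SM (disj_magic goal_atm prog constrs \<union> facts {})"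
    using stable_disj_magic by simp
  show "\<not> pre_model (prog \<union> constrs \<union> facts {})
      (restrict_to {magic_goal, adorned_goal, upper_atm goal_atm, goal_atm}
        (prog \<union> constrs \<union> facts {}))"
    by (simp add: pre_model_def SM_empty)
qed

end
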